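(* The operator $\mathcal Q_{\mathcal H,\mu}$ is a quasi-histopolation operator: with $k=\min_{\iota=1,\dots,M}(k_\iota-1)\ (\ge d)$, for every polynomial $p$ of degree at most $k$ one has $$\mathcal Q_{\mathcal H,\mu}[p](x)=p(x),\qquad x\in[a,b].$$
   Context: Let $a=x_0<x_1<\dots<x_n=b$ be real nodes, $s_i=[x_{i-1},x_i]$ ($i=1,\dots,n$), $\mathcal S_n=\{s_1,\dots,s_n\}$. The data of an integrable function $f$ are $\mu_i(f)=\int_{s_i}f(x)\,dx$. Finitely many segments $s_{\sigma(0)},\dots,s_{\sigma(m)}$ ($\sigma$ strictly increasing into $\{1,\dots,n\}$, $m<n$) are marked as containing discontinuities in their interiors; removing them, put $I_0=\bigcup_{k=1}^{\sigma(0)-1}s_k$, $I_\ell=\bigcup_{k=\sigma(\ell-1)+1}^{\sigma(\ell)-1}s_k$ ($1\le\ell\le m$), $I_{m+1}=\bigcup_{k=\sigma(m)+1}^n s_k$ (if no segment is marked, only $I_0=[a,b]$). Let $h^{\min}$ be the smallest length of a nonempty $I_\ell$. Fix an integer $d\ge0$. Let $r_d$ be the infimum of the $r>0$ with $r\le h^{\min}$ such that every $x\in\bigcup_\ell I_\ell$ admits a closed interval $I\subset\bigcup_\ell I_\ell$ of length $r$ and a segment $s\in\mathcal S_n$ with $x\in s\subset I$, where $I$ contains at least $d+1$ segments of $\mathcal S_n$; $r_d$ is assumed to exist. Each nonempty $I_\ell$ is covered by a finite family of closed intervals $U_{\ell,1},\dots,U_{\ell,n_\ell}\subset I_\ell$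 of length $r_d$, consecutive ones intersecting, each containing at least $d+1$ segments of $\mathcal S_n$, such that every $x\in I_\ell$ lies in a segment $s\in\mathcal S_n$ with $x\in s\subset U_{\ell,j}$ for some $j$; the family is minimal with this property. All the intervals $U_{\ell,j}$ are relabelled $U_1,\dots,U_M$, with $U_\iota=[a_\iota,b_\iota]$. For each $\iota$ let $\mathcal S_\iota=\{s_i\in\mathcal S_n: s_i\subset U_\iota\}$, let $k_\iota$ be the cardinality of $\mathcal S_\iota$, and let $p_\iota=p_\iota(f,\cdot)$ be the unique polynomial of degree at most $k_\iota-1$ with $\int_s p_\iota=\int_s f$ for all $s\in\mathcal S_\iota$ (the histopolation polynomial). Let $K\in\mathbb N$ and let $C_\iota=\{\xi^\iota_1<\dots<\xi^\iota_K\}\subset(a_\iota,b_\iota)$. For $\mu$ a positive even integer, the multinode Shepard functions are $$W_{\mu,\iota}(x)=\frac{\prod_{\kappa=1}^K|x-\xi^\iota_\kappa|^{-\mu}}{\sum_{\lambda=1}^M\prod_{\kappa=1}^K|x-\xi^\lambda_\kappa|^{-\mu}},\qquad x\in[a,b],$$ extended by continuity (removable singularities) at the points $\xi^\lambda_\kappa$. Define $$\mathcal Q_{\mathcal H,\mu}[f](x)=\sum_{\iota=1}^M W_{\mu,\iota}(x)\,p_\iota(f,x).$$ A quasi-histopolation operator is an operator using the integral data $\mu_i(f)$ and reproducing all polynomials of degree at most some $k$ (the paper's definition also mentions, informally, that $\mu_i$ of the approximant is approximately equal to $\mu_i(f)$; reproduction of polynomials is the precise requirement). *)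

theory Defs
  imports "HOL-Analysis.Analysis" "HOL-Computational_Algebra.Polynomial"
begin

definition segment :: "(nat \<Rightarrow> real) \<Rightarrow> nat \<Rightarrow> real set" where
  "segment x i = {x (i - 1)..x i}"

definition segments :: "(nat \<Rightarrow> real) \<Rightarrow> nat \<Rightarrow> real set set" where
  "segments x n = segment x ` {1..n}"

definition segments_in :: "(nat \<Rightarrow> real) \<Rightarrow> nat \<Rightarrow> real set \<Rightarrow> real set set" where
  "segments_in x n U = {s \<in> segments x n. s \<subseteq> U}"

definition segment_data :: "(nat \<Rightarrow> real) \<Rightarrow> nat \<Rightarrow> (real \<Rightarrow> real) \<Rightarrow> real" where
  "segment_data x i f = integral (segment x i) f"

(* The increasing list \<sigma> = [\<sigma>(0), ..., \<sigma>(m)] holds the indices of the marked segments, so that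
   length \<sigma> = m + 1; it is empty if no segment is marked.  The pieces are I_l for
   l = 0, ..., length \<sigma>, and some of them may be empty. *)
definition piece :: "(nat \<Rightarrow> real) \<Rightarrow> nat \<Rightarrow> nat list \<Rightarrow> nat \<Rightarrow> real set" where
  "piece x n \<sigma> l =
     (\<Union>k\<in>{(if l = 0 then 1 else \<sigma> ! (l - 1) + 1)..<(if l < length \<sigma> then \<sigma> ! l else n + 1)}.
        segment x k)"

definition nonempty_pieces :: "(nat \<Rightarrow> real) \<Rightarrow> nat \<Rightarrow> nat list \<Rightarrow> nat set" where
  "nonempty_pieces x n \<sigma> = {l. l \<le> length \<sigma> \<and> piece x n \<sigma> l \<noteq> {}}"

definition h_min :: "(nat \<Rightarrow> real) \<Rightarrow> nat \<Rightarrow> nat list \<Rightarrow> real" where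
  "h_min x n \<sigma> = Min ((\<lambda>l. measure lborel (piece x n \<sigma> l)) ` nonempty_pieces x n \<sigma>)"

definition admissible_lengths :: "(nat \<Rightarrow> real) \<Rightarrow> nat \<Rightarrow> nat list \<Rightarrow> nat \<Rightarrow> real set" where
  "admissible_lengths x n \<sigma> d =
     {r. 0 < r \<and> r \<le> h_min x n \<sigma> \<and>
        (\<forall>y\<in>(\<Union>l\<le>length \<sigma>. piece x n \<sigma> l). \<exists>\<alpha> \<beta>. \<beta> - \<alpha> = r \<and>
           {\<alpha>..\<beta>} \<subseteq> (\<Union>l\<le>length \<sigma>. piece x n \<sigma> l) \<and>
           (\<exists>s\<in>segments x n. y \<in> s \<and> s \<subseteq> {\<alpha>..\<beta>}) \<and>
           d + 1 \<le> card (segments_in x n {\<alpha>..\<beta>}))}"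

definition r_inf :: "(nat \<Rightarrow> real) \<Rightarrow> nat \<Rightarrow> nat list \<Rightarrow> nat \<Rightarrow> real" where
  "r_inf x n \<sigma> d = Inf (admissible_lengths x n \<sigma> d)"

(* A family of closed intervals is the list of its pairs of end points. *)
definition covering_family ::
  "(nat \<Rightarrow> real) \<Rightarrow> nat \<Rightarrow> nat \<Rightarrow> real \<Rightarrow> real set \<Rightarrow> (real \<times> real) list \<Rightarrow> bool" where
  "covering_family x n d r I Us \<longleftrightarrow>
     (\<forall>(\<alpha>, \<beta>)\<in>set Us. \<beta> - \<alpha> = r \<and> {\<alpha>..\<beta>} \<subseteq> I \<and> d + 1 \<le> card (segments_in x n {\<alpha>..\<beta>})) \<and>
     (\<forall>j. Suc j < length Us \<longrightarrow>
        {fst (Us ! j)..snd (Us ! j)} \<inter> {fst (Us ! Suc j)..snd (Us ! Suc j)} \<noteq> {}) \<and>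
     (\<forall>y\<in>I. \<exists>s\<in>segments x n. \<exists>(\<alpha>, \<beta>)\<in>set Us. y \<in> s \<and> s \<subseteq> {\<alpha>..\<beta>})"

(* Minimality with respect to inclusion: no proper subfamily, kept in the same order, has all
   the required properties.  Every other reading (fewest intervals, or no proper subfamily
   covering) implies this one. *)
definition minimal_covering_family ::
  "(nat \<Rightarrow> real) \<Rightarrow> nat \<Rightarrow> nat \<Rightarrow> real \<Rightarrow> real set \<Rightarrow> (real \<times> real) list \<Rightarrow> bool" where
  "minimal_covering_family x n d r I Us \<longleftrightarrow>
     covering_family x n d r I Us \<and>
     (\<forall>J. J \<subset> {..<length Us} \<longrightarrow> \<not> covering_family x n d r I (nths Us J))"

definition histopolant :: "real set set \<Rightarrow> (real \<Rightarrow> real) \<Rightarrow> real poly" where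
  "histopolant S f =
     (THE p. degree p \<le> card S - 1 \<and> (\<forall>s\<in>S. integral s (poly p) = integral s f))"

(* The quotient defining W away from the points \<xi> l \<kappa>, where 0 powi (-\<mu>) = 0 makes it
   meaningless. *)
definition shepard_quotient ::
  "nat \<Rightarrow> nat \<Rightarrow> nat \<Rightarrow> (nat \<Rightarrow> nat \<Rightarrow> real) \<Rightarrow> nat \<Rightarrow> real \<Rightarrow> real" where
  "shepard_quotient \<mu> M K \<xi> \<iota> y =
     (\<Prod>\<kappa>=1..K. \<bar>y - \<xi> \<iota> \<kappa>\<bar> powi (- int \<mu>)) /
     (\<Sum>l=1..M. \<Prod>\<kappa>=1..K. \<bar>y - \<xi> l \<kappa>\<bar> powi (- int \<mu>))"

definition multinode_shepard ::
  "real \<Rightarrow> real \<Rightarrow> nat \<Rightarrow> nat \<Rightarrow> nat \<Rightarrow> (nat \<Rightarrow> nat \<Rightarrow> real) \<Rightarrow> nat \<Rightarrow> real \<Rightarrow> real" where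
  "multinode_shepard a b \<mu> M K \<xi> \<iota> y =
     (if \<exists>l\<in>{1..M}. \<exists>\<kappa>\<in>{1..K}. y = \<xi> l \<kappa>
      then Lim (at y within {a..b}) (shepard_quotient \<mu> M K \<xi> \<iota>)
      else shepard_quotient \<mu> M K \<xi> \<iota> y)"

definition multinode_shepard_operator ::
  "(nat \<Rightarrow> real) \<Rightarrow> nat \<Rightarrow> (nat \<Rightarrow> real) \<Rightarrow> (nat \<Rightarrow> real) \<Rightarrow> nat \<Rightarrow> nat \<Rightarrow> nat \<Rightarrow>
   (nat \<Rightarrow> nat \<Rightarrow> real) \<Rightarrow> (real \<Rightarrow> real) \<Rightarrow> real \<Rightarrow> real" where
  "multinode_shepard_operator x n \<alpha> \<beta> \<mu> M K \<xi> f y =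
     (\<Sum>\<iota>=1..M. multinode_shepard (x 0) (x n) \<mu> M K \<xi> \<iota> y *
        poly (histopolant (segments_in x n {\<alpha> \<iota>..\<beta> \<iota>}) f) y)"

definition reproduces_polynomials ::
  "real \<Rightarrow> real \<Rightarrow> nat \<Rightarrow> ((real \<Rightarrow> real) \<Rightarrow> real \<Rightarrow> real) \<Rightarrow> bool" where
  "reproduces_polynomials a b k Q \<longleftrightarrow>
     (\<forall>p::real poly. degree p \<le> k \<longrightarrow> (\<forall>y\<in>{a..b}. Q (poly p) y = poly p y))"

(* "Using the integral data" means that the value of Q at f is a function of the numbers
   segment_data x i f only. *)
definition quasi_histopolation_operator ::
  "(nat \<Rightarrow> real) \<Rightarrow> nat \<Rightarrow> ((real \<Rightarrow> real) \<Rightarrow> real \<Rightarrow> real) \<Rightarrow> bool" where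
  "quasi_histopolation_operator x n Q \<longleftrightarrow>
     (\<forall>f g. f absolutely_integrable_on {x 0..x n} \<longrightarrow> g absolutely_integrable_on {x 0..x n} \<longrightarrow>
        (\<forall>i\<in>{1..n}. segment_data x i f = segment_data x i g) \<longrightarrow>
        (\<forall>y\<in>{x 0..x n}. Q f y = Q g y)) \<and>
     (\<exists>k. reproduces_polynomials (x 0) (x n) k Q)"

end

theory Submission
  imports Defs
begin

text \<open>
  Two facts carry the proof. First, histopolation polynomials on segments with disjoint interiors
  are unique: a polynomial whose integral over a segment vanishes has a root inside that segment, so
  \<open>N\<close> vanishing integrals force \<open>N\<close> distinct roots, more than a nonzero polynomial
  of degree below \<open>N\<close> can have. Hence a polynomial of degree at most \<open>k\<^sub>\<iota> - 1\<close> is its own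
  histopolant on \<open>U\<^sub>\<iota>\<close>; this is \<open>histopolant_poly\<close>. Second, the multinode
  Shepard functions form a partition of unity on \<open>[a, b]\<close>; this is
  \<open>sum_multinode_shepard\<close>. Away from the nodes that holds because all the quotients have the same
  nonzero denominator. At a node \<open>y\<close> each value is a limit, and multiplying
  numerator and denominator by \<open>\<bar>t - y\<bar>\<^sup>\<mu>\<close> shows that it exists and that the limits
  still add up to one.

  For \<open>deg p \<le> k\<close> every local histopolant is therefore \<open>p\<close> itself, and the operator
  returns a combination of copies of \<open>p\<close> with weights of sum one. The bound \<open>d \<le> k\<close> is
  the requirement that each covering interval contains at least \<open>d + 1\<close> segments.
  The operator uses the integral data only, since each histopolant is determined by the
  integrals over the segments and the weights do not depend on the function.
\<close>

section \<open>Uniqueness of the histopolation polynomial\<close>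

text \<open>
  The antiderivative that vanishes at \<open>u\<close> also vanishes at \<open>v\<close>, so Rolle's theorem
  gives the zero.
\<close>

lemma integral_eq_0_imp_zero_in_interior:
  fixes f :: "real \<Rightarrow> real"
  assumes "u < v" and cont: "continuous_on {u..v} f" and int0: "integral {u..v} f = 0"
  obtains z where "u < z" "z < v" "f z = 0"
proof -
  define F where "F t = integral {u..t} f" for t
  have deriv: "(F has_real_derivative f t) (at t within {u..v})" if "t \<in> {u..v}" for t
    unfolding F_def using integral_has_real_derivative[OF cont that] .
  have deriv_interior: "(F has_real_derivative f t) (at t)" if "u < t" "t < v" for t
    using deriv[of t] that at_within_Icc_at[of u t v] by simp
  have "continuous_on {u..v} F"
    using deriv by (meson continuous_on_eq_continuous_within DERIV_continuous)
  moreover have "F u = F v"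
    using int0 by (simp add: F_def)
  ultimately obtain z where "u < z" "z < v" "DERIV F z :> 0"
    using Rolle[of u v F] \<open>u < v\<close> deriv_interior real_differentiable_def by blast
  with deriv_interior have "f z = 0"
    using DERIV_unique by blast
  with \<open>u < z\<close> \<open>z < v\<close> show thesis by (rule that)
qed

lemma poly_eq_0_if_integrals_eq_0:
  fixes q :: "real poly"
  assumes deg: "degree q < card S"
    and intervals: "\<And>s. s \<in> S \<Longrightarrow> \<exists>u v. u < v \<and> s = {u..v}"
    and disj: "pairwise (\<lambda>s t. interior s \<inter> interior t = {}) S"
    and int0: "\<And>s. s \<in> S \<Longrightarrow> integral s (poly q) = 0"
  shows "q = 0"
proof (rule ccontr)
  assume "q \<noteq> 0"
  have "\<exists>z. z \<in> interior s \<and> poly q z = 0" if "s \<in> S" for s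
  proof -
    obtain u v where "u < v" and s: "s = {u..v}" using intervals[OF \<open>s \<in> S\<close>] by blast
    moreover have "continuous_on {u..v} (poly q)" by (intro continuous_intros)
    ultimately show ?thesis
      using integral_eq_0_imp_zero_in_interior[of u v "poly q"] int0[OF that]
      by (metis greaterThanLessThan_iff interior_atLeastAtMost_real)
  qed
  then obtain z where z: "\<And>s. s \<in> S \<Longrightarrow> z s \<in> interior s \<and> poly q (z s) = 0" by metis
  have "inj_on z S"
  proof (rule inj_onI)
    fix s t assume "s \<in> S" "t \<in> S" "z s = z t"
    with z have "interior s \<inter> interior t \<noteq> {}" by (metis IntI empty_iff)
    with disj \<open>s \<in> S\<close> \<open>t \<in> S\<close> show "s = t" by (auto simp: pairwise_def)
  qed
  then have "card S = card (z ` S)" by (simp add: card_image)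
  also have "\<dots> \<le> card {t. poly q t = 0}"
    using z poly_roots_finite[OF \<open>q \<noteq> 0\<close>] by (intro card_mono) auto
  also have "\<dots> \<le> degree q" by (rule card_poly_roots_bound[OF \<open>q \<noteq> 0\<close>])
  finally show False using deg by simp
qed

lemma histopolant_poly:
  fixes p :: "real poly"
  assumes deg: "degree p < card S"
    and intervals: "\<And>s. s \<in> S \<Longrightarrow> \<exists>u v. u < v \<and> s = {u..v}"
    and disj: "pairwise (\<lambda>s t. interior s \<inter> interior t = {}) S"
  shows "histopolant S (poly p) = p"
  unfolding histopolant_def
proof (rule the_equality)
  show "degree p \<le> card S - 1 \<and> (\<forall>s\<in>S. integral s (poly p) = integral s (poly p))"
    using deg by simp
next
  fix q assume q: "degree q \<le> card S - 1 \<and> (\<forall>s\<in>S. integral s (poly q) = integral s (poly p))"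
  have "q - p = 0"
  proof (rule poly_eq_0_if_integrals_eq_0[OF _ intervals disj])
    show "degree (q - p) < card S"
      using q deg by (intro degree_diff_less) auto
    show "integral s (poly (q - p)) = 0" if "s \<in> S" for s
    proof -
      obtain u v where s: "s = {u..v}" using intervals[OF \<open>s \<in> S\<close>] by blast
      have "poly r integrable_on s" for r :: "real poly"
        unfolding s by (intro integrable_continuous_interval continuous_intros)
      moreover have "poly (q - p) = (\<lambda>t. poly q t - poly p t)" by auto
      ultimately show ?thesis using q that by (simp add: integral_diff)
    qed
  qed
  then show "q = p" by simp
qed

section \<open>Segments of a partition\<close>

lemma segments_in_intervals:
  assumes mono: "strict_mono_on {0..n} x" and "s \<in> segments_in x n U"
  shows "\<exists>u v. u < v \<and> s = {u..v}"
proof -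
  obtain i where i: "i \<in> {1..n}" "s = {x (i - 1)..x i}"
    using assms(2) by (auto simp: segments_in_def segments_def segment_def)
  then have "x (i - 1) < x i" using strict_mono_onD[OF mono, of "i - 1" i] by auto
  with i show ?thesis by blast
qed

lemma segments_in_interiors_disjoint:
  assumes mono: "strict_mono_on {0..n} x"
  shows "pairwise (\<lambda>s t. interior s \<inter> interior t = {}) (segments_in x n U)"
proof -
  have ordered: "interior (segment x i) \<inter> interior (segment x j) = {}"
    if "i < j" "j \<le> n" for i j
  proof -
    have "x i \<le> x (j - 1)"
      using that by (intro strict_mono_on_leD[OF mono]) auto
    then show ?thesis by (auto simp: segment_def)
  qed
  have "interior (segment x i) \<inter> interior (segment x j) = {}"
    if "i \<in> {1..n}" "j \<in> {1..n}" "i \<noteq> j" for i j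
    using ordered[of i j] ordered[of j i] that by (cases i j rule: linorder_cases) auto
  then show ?thesis
    unfolding pairwise_def segments_in_def segments_def by blast
qed

text \<open>
  The function enters the characterisation of the histopolant only through its integrals over the
  segments. This is why the operator uses the integral data alone.
\<close>

lemma histopolant_segments_in_cong:
  assumes "\<And>i. i \<in> {1..n} \<Longrightarrow> segment_data x i f = segment_data x i g"
  shows "histopolant (segments_in x n U) f = histopolant (segments_in x n U) g"
proof -
  have "integral s f = integral s g" if "s \<in> segments_in x n U" for s
    using that assms by (auto simp: segments_in_def segments_def segment_data_def)
  then show ?thesis by (simp add: histopolant_def)
qed

section \<open>The multinode Shepard partition of unity\<close>

lemma sum_shepard_quotient:
  assumes "1 \<le> M" and "\<forall>l\<in>{1..M}. \<forall>\<kappa>\<in>{1..K}. y \<noteq> \<xi> l \<kappa>"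
  shows "(\<Sum>\<iota>=1..M. shepard_quotient \<mu> M K \<xi> \<iota> y) = 1"
proof -
  have "(\<Sum>l=1..M. \<Prod>\<kappa>=1..K. \<bar>y - \<xi> l \<kappa>\<bar> powi (- int \<mu>)) > 0"
    using assms by (intro sum_pos prod_pos zero_less_power_int) auto
  then show ?thesis
    by (simp add: shepard_quotient_def flip: sum_divide_distrib)
qed

text \<open>
  The product \<open>\<bar>t - y\<bar>\<^sup>\<mu> \<cdot> (\<Prod>\<kappa>. \<bar>t - c \<kappa>\<bar> powi (-\<mu>))\<close> with its singularity at
  \<open>y\<close> cancelled, where at most one node may be equal to \<open>y\<close>.
\<close>

definition cleared_prod ::
  "nat \<Rightarrow> nat \<Rightarrow> (nat \<Rightarrow> real) \<Rightarrow> real \<Rightarrow> real \<Rightarrow> real" where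
  "cleared_prod \<mu> K c y t =
     (if y \<in> c ` {1..K} then 1 else \<bar>t - y\<bar> ^ \<mu>) *
     (\<Prod>\<kappa>\<in>{\<kappa>\<in>{1..K}. c \<kappa> \<noteq> y}. inverse (\<bar>t - c \<kappa>\<bar> ^ \<mu>))"

lemma cleared_prod_eq:
  assumes inj: "inj_on c {1..K}" and "t \<noteq> y"
  shows "\<bar>t - y\<bar> ^ \<mu> * (\<Prod>\<kappa>=1..K. \<bar>t - c \<kappa>\<bar> powi (- int \<mu>)) = cleared_prod \<mu> K c y t"
proof (cases "y \<in> c ` {1..K}")
  case True
  then obtain \<kappa>\<^sub>0 where \<kappa>\<^sub>0: "\<kappa>\<^sub>0 \<in> {1..K}" "y = c \<kappa>\<^sub>0" by blast
  have "c \<kappa> = y \<longleftrightarrow> \<kappa> = \<kappa>\<^sub>0" if "\<kappa> \<in> {1..K}" for \<kappa>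
    using inj_on_eq_iff[OF inj that \<kappa>\<^sub>0(1)] \<kappa>\<^sub>0(2) by simp
  then have "{\<kappa>\<in>{1..K}. c \<kappa> \<noteq> y} = {1..K} - {\<kappa>\<^sub>0}"
    by blast
  then have cleared: "cleared_prod \<mu> K c y t = (\<Prod>\<kappa>\<in>{1..K} - {\<kappa>\<^sub>0}. inverse (\<bar>t - c \<kappa>\<bar> ^ \<mu>))"
    using True by (simp add: cleared_prod_def)
  have "(\<Prod>\<kappa>=1..K. \<bar>t - c \<kappa>\<bar> powi (- int \<mu>)) = inverse (\<bar>t - y\<bar> ^ \<mu>) * cleared_prod \<mu> K c y t"
    unfolding cleared
    using prod.remove[OF _ \<kappa>\<^sub>0(1), of "\<lambda>\<kappa>. inverse (\<bar>t - c \<kappa>\<bar> ^ \<mu>)"] \<kappa>\<^sub>0(2)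
    by (simp add: power_int_minus)
  then show ?thesis using \<open>t \<noteq> y\<close> by simp
next
  case False
  then have "{\<kappa>\<in>{1..K}. c \<kappa> \<noteq> y} = {1..K}" by auto
  with False show ?thesis by (simp add: cleared_prod_def power_int_minus)
qed

lemma isCont_cleared_prod: "isCont (cleared_prod \<mu> K c y) y"
proof -
  have "isCont (\<lambda>t. if y \<in> c ` {1..K} then 1 else \<bar>t - y\<bar> ^ \<mu>) y"
    by (cases "y \<in> c ` {1..K}") simp_all
  then show ?thesis
    unfolding cleared_prod_def by (intro continuous_intros) auto
qed

lemma cleared_prod_nonneg: "0 \<le> cleared_prod \<mu> K c y t"
  unfolding cleared_prod_def by (intro mult_nonneg_nonneg prod_nonneg) auto

lemma cleared_prod_pos: "y \<in> c ` {1..K} \<Longrightarrow> 0 < cleared_prod \<mu> K c y y"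
  unfolding cleared_prod_def by (auto intro!: prod_pos)

text \<open>
  After the common factor \<open>\<bar>t - y\<bar>\<^sup>\<mu>\<close> is cancelled the denominator is continuous at \<open>y\<close>, and
  the summand that belongs to a family containing \<open>y\<close> keeps it positive there.
\<close>

lemma shepard_quotient_tendsto:
  assumes inj: "\<And>l. l \<in> {1..M} \<Longrightarrow> inj_on (\<xi> l) {1..K}"
    and node: "l\<^sub>0 \<in> {1..M}" "y \<in> \<xi> l\<^sub>0 ` {1..K}" and \<iota>: "\<iota> \<in> {1..M}"
  shows "(shepard_quotient \<mu> M K \<xi> \<iota> \<longlongrightarrow>
           cleared_prod \<mu> K (\<xi> \<iota>) y y / (\<Sum>l=1..M. cleared_prod \<mu> K (\<xi> l) y y)) (at y within A)"
proof -
  have "(\<Sum>l=1..M. cleared_prod \<mu> K (\<xi> l) y y) > 0"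
    using node by (intro sum_pos2[of _ l\<^sub>0] cleared_prod_pos cleared_prod_nonneg) auto
  then have "((\<lambda>t. cleared_prod \<mu> K (\<xi> \<iota>) y t / (\<Sum>l=1..M. cleared_prod \<mu> K (\<xi> l) y t)) \<longlongrightarrow>
           cleared_prod \<mu> K (\<xi> \<iota>) y y / (\<Sum>l=1..M. cleared_prod \<mu> K (\<xi> l) y y)) (at y)"
    by (intro tendsto_intros isCont_cleared_prod[unfolded isCont_def]) auto
  then have lim: "((\<lambda>t. cleared_prod \<mu> K (\<xi> \<iota>) y t / (\<Sum>l=1..M. cleared_prod \<mu> K (\<xi> l) y t)) \<longlongrightarrow>
           cleared_prod \<mu> K (\<xi> \<iota>) y y / (\<Sum>l=1..M. cleared_prod \<mu> K (\<xi> l) y y)) (at y within A)"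
    by (rule tendsto_within_subset[OF _ subset_UNIV])
  have quot: "cleared_prod \<mu> K (\<xi> \<iota>) y t / (\<Sum>l=1..M. cleared_prod \<mu> K (\<xi> l) y t)
      = shepard_quotient \<mu> M K \<xi> \<iota> t" if "t \<noteq> y" for t
  proof -
    let ?P = "\<lambda>l. \<Prod>\<kappa>=1..K. \<bar>t - \<xi> l \<kappa>\<bar> powi (- int \<mu>)"
    have cleared: "cleared_prod \<mu> K (\<xi> l) y t = \<bar>t - y\<bar> ^ \<mu> * ?P l" if "l \<in> {1..M}" for l
      using cleared_prod_eq[OF inj[OF that] \<open>t \<noteq> y\<close>, of \<mu>] by simp
    then have "(\<Sum>l=1..M. cleared_prod \<mu> K (\<xi> l) y t) = \<bar>t - y\<bar> ^ \<mu> * (\<Sum>l=1..M. ?P l)"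
      by (simp add: sum_distrib_left)
    then show ?thesis
      unfolding cleared[OF \<iota>] shepard_quotient_def using \<open>t \<noteq> y\<close> by simp
  qed
  show ?thesis
    using quot by (intro Lim_transform_eventually[OF lim]) (auto simp: eventually_at_filter)
qed

lemma sum_multinode_shepard:
  assumes "1 \<le> M" and inj: "\<And>l. l \<in> {1..M} \<Longrightarrow> inj_on (\<xi> l) {1..K}"
    and "a < b" and y: "y \<in> {a..b}"
  shows "(\<Sum>\<iota>=1..M. multinode_shepard a b \<mu> M K \<xi> \<iota> y) = 1"
proof (cases "\<exists>l\<in>{1..M}. \<exists>\<kappa>\<in>{1..K}. y = \<xi> l \<kappa>")
  case False
  then show ?thesis
    using sum_shepard_quotient[of M K y \<xi> \<mu>] \<open>1 \<le> M\<close> by (simp add: multinode_shepard_def)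
next
  case True
  then obtain l\<^sub>0 where node: "l\<^sub>0 \<in> {1..M}" "y \<in> \<xi> l\<^sub>0 ` {1..K}" by blast
  let ?G = "\<lambda>l. cleared_prod \<mu> K (\<xi> l) y y"
  \<comment> \<open>The limit in the definition is determined because no point of \<open>[a, b]\<close> is isolated.\<close>
  have nontrivial: "\<not> trivial_limit (at y within {a..b})"
    using \<open>a < b\<close> y by (simp add: trivial_limit_within islimpt_Icc)
  have "multinode_shepard a b \<mu> M K \<xi> \<iota> y = ?G \<iota> / (\<Sum>l=1..M. ?G l)" if "\<iota> \<in> {1..M}" for \<iota>
    using tendsto_Lim[OF nontrivial shepard_quotient_tendsto[where \<xi> = \<xi>, OF inj node that]]
    unfolding multinode_shepard_def if_P[OF True] .
  then have "(\<Sum>\<iota>=1..M. multinode_shepard a b \<mu> M K \<xi> \<iota> y) = (\<Sum>\<iota>=1..M. ?G \<iota>) / (\<Sum>l=1..M. ?G l)"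
    by (simp flip: sum_divide_distrib)
  moreover have "(\<Sum>l=1..M. ?G l) > 0"
    using node by (intro sum_pos2[of _ l\<^sub>0] cleared_prod_pos cleared_prod_nonneg) auto
  ultimately show ?thesis by simp
qed

section \<open>Reproduction of polynomials\<close>

lemma multinode_shepard_operator_poly:
  fixes p :: "real poly"
  assumes "1 \<le> n" and mono: "strict_mono_on {0..n} x" and "1 \<le> M"
    and inj: "\<And>l. l \<in> {1..M} \<Longrightarrow> inj_on (\<xi> l) {1..K}"
    and deg: "\<And>\<iota>. \<iota> \<in> {1..M} \<Longrightarrow> degree p < card (segments_in x n {\<alpha> \<iota>..\<beta> \<iota>})"
    and y: "y \<in> {x 0..x n}"
  shows "multinode_shepard_operator x n \<alpha> \<beta> \<mu> M K \<xi> (poly p) y = poly p y"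
proof -
  have "x 0 < x n"
    using \<open>1 \<le> n\<close> strict_mono_onD[OF mono, of 0 n] by simp
  have "histopolant (segments_in x n {\<alpha> \<iota>..\<beta> \<iota>}) (poly p) = p" if "\<iota> \<in> {1..M}" for \<iota>
    using segments_in_intervals[OF mono] segments_in_interiors_disjoint[OF mono]
    by (intro histopolant_poly deg[OF that])
  then have "multinode_shepard_operator x n \<alpha> \<beta> \<mu> M K \<xi> (poly p) y
      = (\<Sum>\<iota>=1..M. multinode_shepard (x 0) (x n) \<mu> M K \<xi> \<iota> y) * poly p y"
    by (simp add: multinode_shepard_operator_def sum_distrib_right)
  also have "\<dots> = poly p y"
    using sum_multinode_shepard[OF \<open>1 \<le> M\<close> inj \<open>x 0 < x n\<close> y] by simp
  finally show ?thesis .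
qed

theorem proposition2p12:
  fixes x :: "nat \<Rightarrow> real" and a b :: real
    and n d M K \<mu> k :: nat
    and \<sigma> :: "nat list"
    and Us :: "nat \<Rightarrow> (real \<times> real) list"
    and \<tau> :: "nat \<Rightarrow> nat \<times> nat"
    and \<alpha> \<beta> :: "nat \<Rightarrow> real"
    and \<xi> :: "nat \<Rightarrow> nat \<Rightarrow> real"
  assumes "1 \<le> n" and "strict_mono_on {0..n} x" and "x 0 = a" and "x n = b"
    and "sorted_wrt (<) \<sigma>" and "set \<sigma> \<subseteq> {1..n}"
    and "nonempty_pieces x n \<sigma> \<noteq> {}"
    and "admissible_lengths x n \<sigma> d \<noteq> {}"
    and "\<And>l. l \<in> nonempty_pieces x n \<sigma> \<Longrightarrow>
           minimal_covering_family x n d (r_inf x n \<sigma> d) (piece x n \<sigma> l) (Us l)"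
    and "bij_betw \<tau> {1..M} {(l, j). l \<in> nonempty_pieces x n \<sigma> \<and> j < length (Us l)}"
    and "\<And>\<iota>. \<iota> \<in> {1..M} \<Longrightarrow> (\<alpha> \<iota>, \<beta> \<iota>) = Us (fst (\<tau> \<iota>)) ! snd (\<tau> \<iota>)"
    and "\<And>\<iota>. \<iota> \<in> {1..M} \<Longrightarrow> strict_mono_on {1..K} (\<xi> \<iota>)"
    and "\<And>\<iota>. \<iota> \<in> {1..M} \<Longrightarrow> \<xi> \<iota> ` {1..K} \<subseteq> {\<alpha> \<iota><..<\<beta> \<iota>}"
    and "0 < \<mu>" and "even \<mu>"
    and "k = (MIN \<iota>\<in>{1..M}. card (segments_in x n {\<alpha> \<iota>..\<beta> \<iota>}) - 1)"
  shows "quasi_histopolation_operator x n (multinode_shepard_operator x n \<alpha> \<beta> \<mu> M K \<xi>) \<and>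
    d \<le> k \<and>
    (\<forall>p::real poly. degree p \<le> k \<longrightarrow>
       (\<forall>y\<in>{a..b}. multinode_shepard_operator x n \<alpha> \<beta> \<mu> M K \<xi> (poly p) y = poly p y))"
proof -
  let ?Q = "multinode_shepard_operator x n \<alpha> \<beta> \<mu> M K \<xi>"
  let ?N = "\<lambda>\<iota>. card (segments_in x n {\<alpha> \<iota>..\<beta> \<iota>})"
  have covering: "covering_family x n d (r_inf x n \<sigma> d) (piece x n \<sigma> l) (Us l)"
    if "l \<in> nonempty_pieces x n \<sigma>" for l
    using assms(9)[OF that] by (simp add: minimal_covering_family_def)
  \<comment> \<open>A nonempty piece contains a point, and the empty family covers no point.\<close>
  have "1 \<le> M"
  proof -
    obtain l y where l: "l \<in> nonempty_pieces x n \<sigma>" and "y \<in> piece x n \<sigma> l"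
      using assms(7) by (auto simp: nonempty_pieces_def)
    with covering have "Us l \<noteq> []" by (fastforce simp: covering_family_def)
    with l have "(l, 0) \<in> {(l, j). l \<in> nonempty_pieces x n \<sigma> \<and> j < length (Us l)}" by simp
    then have "(l, 0) \<in> \<tau> ` {1..M}"
      using bij_betw_imp_surj_on[OF assms(10)] by simp
    then show ?thesis by auto
  qed
  have card_bound: "d + 1 \<le> ?N \<iota>" if "\<iota> \<in> {1..M}" for \<iota>
  proof -
    obtain l j where \<tau>: "\<tau> \<iota> = (l, j)" by fastforce
    with bij_betwE[OF assms(10)] that
    have l: "l \<in> nonempty_pieces x n \<sigma>" and "j < length (Us l)" by fastforce+
    with assms(11)[OF that] \<tau> have "(\<alpha> \<iota>, \<beta> \<iota>) \<in> set (Us l)" by simp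
    with covering[OF l] show ?thesis by (auto simp: covering_family_def)
  qed
  have "k \<in> (\<lambda>\<iota>. ?N \<iota> - 1) ` {1..M}"
    unfolding assms(16) using \<open>1 \<le> M\<close> by (intro Min_in) auto
  then have "d \<le> k" using card_bound by fastforce
  have "k < ?N \<iota>" if "\<iota> \<in> {1..M}" for \<iota>
  proof -
    have "k \<le> ?N \<iota> - 1" unfolding assms(16) using that by (intro Min_le) auto
    with card_bound[OF that] show ?thesis by linarith
  qed
  then have reproduces: "?Q (poly p) y = poly p y" if "degree p \<le> k" "y \<in> {x 0..x n}" for p y
    using assms(1,2,12) \<open>1 \<le> M\<close> that
    by (intro multinode_shepard_operator_poly) (auto intro: strict_mono_on_imp_inj_on le_less_trans)
  have "?Q f y = ?Q g y" if "\<forall>i\<in>{1..n}. segment_data x i f = segment_data x i g" for f g y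
  proof -
    have "histopolant (segments_in x n U) f = histopolant (segments_in x n U) g" for U
      using that by (intro histopolant_segments_in_cong) blast
    then show ?thesis by (simp add: multinode_shepard_operator_def)
  qed
  moreover have "reproduces_polynomials (x 0) (x n) k ?Q"
    using reproduces by (simp add: reproduces_polynomials_def)
  ultimately have "quasi_histopolation_operator x n ?Q"
    unfolding quasi_histopolation_operator_def by blast
  with \<open>d \<le> k\<close> reproduces assms(3,4) show ?thesis by auto
qed

end
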